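(* Let $\Bbbk$ be a field, let $q\in\{-1,1\}$ and $\alpha\in\Bbbk$ with $\alpha\neq0$, and let $\mathbb{L}$ be the $\Bbbk$-algebra generated by $y_1,y_2,x_1,x_2$ subject to the relations $$x_2x_1=q\,x_1x_2,\quad y_2y_1=-y_1y_2,\quad y_1x_1=\alpha x_1y_2,\quad y_1x_2=x_2y_2,\quad y_2x_1=\alpha x_1y_1,\quad y_2x_2=x_2y_1.$$ Let $S\subset\Bbbk\{y_1,y_2,x_1,x_2\}$ be the set consisting of the six polynomials $$x_2x_1-q\,x_1x_2,\quad y_2y_1+y_1y_2,\quad x_1y_2-\tfrac1\alpha y_1x_1,\quad x_2y_2-y_1x_2,\quad x_1y_1-\tfrac1\alpha y_2x_1,\quad x_2y_1-y_2x_2.$$ Then, with respect to the degree lexicographic order with $y_1\prec y_2\prec x_1\prec x_2$, the set $S$ is a Gröbner-Shirshov basis of the ideal $\mathrm{Id}(S)$, which is the ideal of defining relations of $\mathbb{L}$, i.e. $\mathbb{L}=\Bbbk\{y_1,y_2,x_1,x_2\}/\mathrm{Id}(S)$.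
   Context: Let $X=\{y_1,y_2,x_1,x_2\}$, let $X^*$ be the free monoid of words in $X$, and let $\Bbbk\{X\}$ be the free associative unital $\Bbbk$-algebra on $X$ (noncommutative polynomials). $\mathrm{Id}(S)$ denotes the two-sided ideal of $\Bbbk\{X\}$ generated by $S$. The degree lexicographic order $\prec$ on $X^*$ compares words first by length and then, for equal length, lexicographically from left to right with $y_1\prec y_2\prec x_1\prec x_2$. For a nonzero $f\in\Bbbk\{X\}$, $\overline{f}$ denotes its leading (i.e. $\prec$-largest) word; $f$ is monic if the coefficient of $\overline{f}$ is $1$. For monic $f,g$: (i) if $w=\overline{f}a=b\overline{g}$ with $a,b\in X^*$ and $|\overline{f}|+|\overline{g}|>|w|$, then $(f,g)_w:=fa-bg$ is the intersection composition; (ii) if $w=\overline{f}=a\overline{g}b$ with $a,b\in X^*$, then $(f,g)_w:=f-agb$ is the inclusion composition. A composition $(f,g)_w$ is trivial modulo $S$ if $(f,g)_w=\sum_i\alpha_i a_is_ib_i$ (finite sum) with $\alpha_i\in\Bbbk$, $a_i,b_i\in X^*$, $s_i\in S$ and $a_i\overline{s_i}b_i\prec w$ for all $i$. A nonempty set $S$ of monic polynomials is a Gröbner-Shirshov basis of $\mathrm{Id}(S)$ if every composition $(f,g)_w$ with $f,g\in S$ is trivial modulo $S$. *)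

theory Defs
  imports
    "HOL-Algebra.QuotRing"
    "HOL-Algebra.Module"
    "HOL-Library.Poly_Mapping"
    "HOL-Library.List_Lenlexorder"
begin

text \<open>Words are lists. With concatenation as the (additively written) monoid operation on words,
  the convolution product of \<^theory>\<open>HOL-Library.Poly_Mapping\<close> on finitely supported functions
  from words to \<open>'k\<close> is the product of the free associative algebra.\<close>

instantiation list :: (type) monoid_add
begin

definition zero_list :: "'a list" where "zero_list = []"

definition plus_list :: "'a list \<Rightarrow> 'a list \<Rightarrow> 'a list" where "plus_list = (@)"

instance by standard (simp_all add: zero_list_def plus_list_def)

end

type_synonym ('x, 'k) ncpoly = "'x list \<Rightarrow>\<^sub>0 'k"

definition word :: "'x list \<Rightarrow> ('x, 'k::field) ncpoly"
  where "word u = Poly_Mapping.single u 1"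

definition scale :: "'k::field \<Rightarrow> ('x, 'k) ncpoly \<Rightarrow> ('x, 'k) ncpoly"
  where "scale c f = Poly_Mapping.map ((*) c) f"


section \<open>Ideals, quotients and algebras given by generators and relations\<close>

text \<open>The record type \<open>module\<close> is used for \<open>'k\<close>-algebras: a ring together with a scalar
  multiplication. (The locale \<open>algebra\<close> of HOL-Algebra is restricted to commutative algebras.)\<close>

definition free_alg :: "('k::field, ('x, 'k) ncpoly) module"
  where "free_alg = \<lparr>carrier = UNIV, mult = (*), one = 1, zero = 0, add = (+), smult = scale\<rparr>"

definition quot_alg :: "('k, 'a) module \<Rightarrow> 'a set \<Rightarrow> ('k, 'a set) module"
  where "quot_alg A I = ring.extend (A Quot I)
    (module.fields (\<lambda>c U. \<Union>u\<in>U. I +>\<^bsub>A\<^esub> (c \<odot>\<^bsub>A\<^esub> u)))"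

text \<open>The locale \<open>ideal\<close> of HOL-Algebra means two-sided ideals, so \<open>genideal\<close> yields the two-sided
  ideal generated by a set; it is closed under \<open>scale\<close> because the free algebra is unital.\<close>

definition gen_ideal :: "('x, 'k::field) ncpoly set \<Rightarrow> ('x, 'k) ncpoly set"
  where "gen_ideal S = genideal free_alg S"

text \<open>A pair \<open>(l, r)\<close> stands for the relation \<open>l = r\<close>.\<close>

definition presented_alg ::
    "(('x, 'k::field) ncpoly \<times> ('x, 'k) ncpoly) set \<Rightarrow> ('k, ('x, 'k) ncpoly set) module"
  where "presented_alg Rel = quot_alg free_alg (gen_ideal {l - r | l r. (l, r) \<in> Rel})"

text \<open>All polynomials that become zero when the free generators are sent to the generators of
  the presented algebra, i.e. the kernel of the canonical projection.\<close>

definition defining_relations_ideal ::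
    "(('x, 'k::field) ncpoly \<times> ('x, 'k) ncpoly) set \<Rightarrow> ('x, 'k) ncpoly set"
  where "defining_relations_ideal Rel =
    a_kernel free_alg (presented_alg Rel)
      (\<lambda>f. gen_ideal {l - r | l r. (l, r) \<in> Rel} +>\<^bsub>free_alg\<^esub> f)"


section \<open>Groebner-Shirshov bases\<close>

text \<open>By \<^theory>\<open>HOL-Library.List_Lenlexorder\<close>, the order on words is the degree lexicographic
  order induced by the order on letters. Leading words are meaningful for nonzero polynomials only.\<close>

definition lead_word :: "('x::linorder, 'k::field) ncpoly \<Rightarrow> 'x list"
  where "lead_word f = Max (Poly_Mapping.keys f)"

definition monic :: "('x::linorder, 'k::field) ncpoly \<Rightarrow> bool"
  where "monic f \<longleftrightarrow> f \<noteq> 0 \<and> Poly_Mapping.lookup f (lead_word f) = 1"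

text \<open>\<open>composition f g w h\<close>: the polynomial \<open>h\<close> is a composition of \<open>f\<close> and \<open>g\<close> with respect
  to the word \<open>w\<close>.\<close>

inductive composition ::
    "('x::linorder, 'k::field) ncpoly \<Rightarrow> ('x, 'k) ncpoly \<Rightarrow> 'x list \<Rightarrow> ('x, 'k) ncpoly \<Rightarrow> bool"
  where
    intersection:
      "w = lead_word f @ a \<Longrightarrow> w = b @ lead_word g \<Longrightarrow>
        length (lead_word f) + length (lead_word g) > length w \<Longrightarrow>
        composition f g w (f * word a - word b * g)"
  | inclusion:
      "w = lead_word f \<Longrightarrow> w = a @ lead_word g @ b \<Longrightarrow>
        composition f g w (f - word a * g * word b)"

definition trivial_mod ::
    "('x::linorder, 'k::field) ncpoly set \<Rightarrow> 'x list \<Rightarrow> ('x, 'k) ncpoly \<Rightarrow> bool"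
  where "trivial_mod S w h \<longleftrightarrow>
    (\<exists>(n::nat) (c :: nat \<Rightarrow> 'k) a s b.
      h = (\<Sum>i<n. scale (c i) (word (a i) * s i * word (b i))) \<and>
      (\<forall>i<n. s i \<in> S \<and> a i @ lead_word (s i) @ b i < w))"

definition groebner_shirshov_basis :: "('x::linorder, 'k::field) ncpoly set \<Rightarrow> bool"
  where "groebner_shirshov_basis S \<longleftrightarrow>
    S \<noteq> {} \<and> (\<forall>f\<in>S. monic f) \<and>
    (\<forall>f\<in>S. \<forall>g\<in>S. \<forall>w h. composition f g w h \<longrightarrow> trivial_mod S w h)"


section \<open>The four generators\<close>

datatype gen = Y1 | Y2 | X1 | X2

fun rank :: "gen \<Rightarrow> nat"
  where "rank Y1 = 0" | "rank Y2 = 1" | "rank X1 = 2" | "rank X2 = 3"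

instantiation gen :: linorder
begin

definition less_eq_gen :: "gen \<Rightarrow> gen \<Rightarrow> bool" where "less_eq_gen a b \<longleftrightarrow> rank a \<le> rank b"

definition less_gen :: "gen \<Rightarrow> gen \<Rightarrow> bool" where "less_gen a b \<longleftrightarrow> rank a < rank b"

instance
proof
  fix a b :: gen
  show "a \<le> b \<Longrightarrow> b \<le> a \<Longrightarrow> a = b"
    by (cases a; cases b) (simp_all add: less_eq_gen_def)
qed (auto simp: less_eq_gen_def less_gen_def)

end

abbreviation "y1 \<equiv> word [Y1]"
abbreviation "y2 \<equiv> word [Y2]"
abbreviation "x1 \<equiv> word [X1]"
abbreviation "x2 \<equiv> word [X2]"

definition L_rels :: "'k::field \<Rightarrow> 'k \<Rightarrow> ((gen, 'k) ncpoly \<times> (gen, 'k) ncpoly) set"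
  where "L_rels q \<alpha> =
    {(x2 * x1, scale q (x1 * x2)),
     (y2 * y1, - (y1 * y2)),
     (y1 * x1, scale \<alpha> (x1 * y2)),
     (y1 * x2, x2 * y2),
     (y2 * x1, scale \<alpha> (x1 * y1)),
     (y2 * x2, x2 * y1)}"

definition L_alg :: "'k::field \<Rightarrow> 'k \<Rightarrow> ('k, (gen, 'k) ncpoly set) module"
  where "L_alg q \<alpha> = presented_alg (L_rels q \<alpha>)"

definition GS_set :: "'k::field \<Rightarrow> 'k \<Rightarrow> (gen, 'k) ncpoly set"
  where "GS_set q \<alpha> =
    {x2 * x1 - scale q (x1 * x2),
     y2 * y1 + y1 * y2,
     x1 * y2 - scale (1 / \<alpha>) (y1 * x1),
     x2 * y2 - y1 * x2,
     x1 * y1 - scale (1 / \<alpha>) (y2 * x1),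
     x2 * y1 - y2 * x2}"

end

theory Submission
  imports Defs
begin

text \<open>Read from the leading word to the rest, each of the six polynomials is a rewriting rule that
  replaces a word of length two by a multiple of a smaller word:
  \<open>x\<^sub>2 x\<^sub>1 \<rightarrow> q x\<^sub>1 x\<^sub>2\<close>, \<open>y\<^sub>2 y\<^sub>1 \<rightarrow> - y\<^sub>1 y\<^sub>2\<close>, and \<open>x\<^sub>i y\<^sub>j \<rightarrow> p\<^sub>i \<sigma>(y\<^sub>j) x\<^sub>i\<close>, where \<open>\<sigma>\<close> swaps \<open>y\<^sub>1\<close> and
  \<open>y\<^sub>2\<close>, and \<open>p\<^sub>1 = 1/\<alpha>\<close>, \<open>p\<^sub>2 = 1\<close>. For such a system only the overlaps of length three matter
  (\<open>groebner_shirshov_basis_quadratic\<close>): a composition is the difference of the two one-step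
  rewritings of the overlap, and it is trivial once both rewrite to the same multiple of a word,
  because each rewriting step below the overlap subtracts an admissible multiple of an element of
  \<open>S\<close> (\<open>cong_below_rewrite\<close>).

  The overlaps are \<open>x\<^sub>2 x\<^sub>1 y\<^sub>j\<close> and \<open>x\<^sub>i y\<^sub>2 y\<^sub>1\<close>. The first kind resolves since \<open>p\<^sub>i\<close> does not depend on
  \<open>j\<close>: both sides reduce to \<open>q p\<^sub>1 p\<^sub>2 y\<^sub>j x\<^sub>1 x\<^sub>2\<close> (\<open>overlap_xxy\<close>). The second kind resolves since the
  relation between the \<open>y\<^sub>j\<close> is invariant under \<open>\<sigma>\<close>: both sides reduce to \<open>p\<^sub>i\<^sup>2 y\<^sub>1 y\<^sub>2 x\<^sub>i\<close>
  (\<open>overlap_xyy\<close>).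

  The statements about ideals hold because every element of \<open>S\<close> is a nonzero multiple of the
  difference of the two sides of a defining relation, and conversely
  (\<open>gen_ideal_relations\<close>).\<close>


section \<open>Scalars and words in the free algebra\<close>

lemma scale_conv_mult: "scale c f = Poly_Mapping.single 0 c * f"
  by (simp add: scale_def mult_map_scale_conv_mult)

lemma scale_scale [simp]: "scale c (scale d f) = scale (c * d) f"
  by (simp add: scale_conv_mult mult.assoc [symmetric] mult_single)

lemma scale_one [simp]: "scale 1 f = f"
  by (simp add: scale_conv_mult)

lemma scale_diff: "scale c (f - g) = scale c f - scale c g"
  by (simp add: scale_conv_mult algebra_simps)

lemma scale_uminus: "scale (- c) f = - scale c f"
  by (simp add: scale_conv_mult single_uminus)

lemma word_mult: "word u * word v = word (u @ v)"
  by (simp add: word_def mult_single plus_list_def)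

lemma word_mult_scale: "word u * scale c (word v) = scale c (word (u @ v))"
  by (simp add: scale_conv_mult word_def mult_single plus_list_def zero_list_def)

lemma scale_mult_word: "scale c f * g = scale c (f * g)"
  by (simp add: scale_conv_mult mult.assoc)

lemma lookup_scale_word:
  "Poly_Mapping.lookup (scale c (word u)) v = (if v = u then c else 0)"
  by (simp add: scale_conv_mult word_def mult_single lookup_single when_def)


section \<open>Congruence below a word\<close>

lemma trivial_mod_zero: "trivial_mod S w 0"
  unfolding trivial_mod_def by (rule exI [of _ 0]) simp

lemma trivial_mod_add_term:
  assumes "trivial_mod S w f" and "s \<in> S" and "a @ lead_word s @ b < w"
  shows "trivial_mod S w (f + scale c (word a * s * word b))"
proof -
  obtain n :: nat and c' a' s' b'
    where f: "f = (\<Sum>i<n. scale (c' i) (word (a' i) * s' i * word (b' i)))"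
      and terms: "\<forall>i<n. s' i \<in> S \<and> a' i @ lead_word (s' i) @ b' i < w"
    using assms(1) unfolding trivial_mod_def by blast
  have "f + scale c (word a * s * word b) =
      (\<Sum>i<Suc n. scale ((c'(n := c)) i)
        (word ((a'(n := a)) i) * (s'(n := s)) i * word ((b'(n := b)) i)))"
    by (simp add: f)
  moreover have "\<forall>i<Suc n. (s'(n := s)) i \<in> S \<and>
      (a'(n := a)) i @ lead_word ((s'(n := s)) i) @ (b'(n := b)) i < w"
    using terms assms(2,3) by (auto simp: less_Suc_eq)
  ultimately show ?thesis
    unfolding trivial_mod_def by blast
qed

text \<open>Appending the terms of one sum to the other one at a time avoids splicing the two indexed
  families.\<close>

lemma trivial_mod_add:
  assumes "trivial_mod S w f" and "trivial_mod S w g"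
  shows "trivial_mod S w (f + g)"
proof -
  obtain n :: nat and c a s b
    where g: "g = (\<Sum>i<n. scale (c i) (word (a i) * s i * word (b i)))"
      and terms: "\<forall>i<n. s i \<in> S \<and> a i @ lead_word (s i) @ b i < w"
    using assms(2) unfolding trivial_mod_def by blast
  have "trivial_mod S w (f + (\<Sum>i<k. scale (c i) (word (a i) * s i * word (b i))))"
    if "k \<le> n" for k
    using that
  proof (induction k)
    case 0
    show ?case using assms(1) by simp
  next
    case (Suc k)
    then show ?case
      using trivial_mod_add_term [of S w _ "s k" "a k" "b k" "c k"] terms
      by (simp add: add.assoc [symmetric])
  qed
  then show ?thesis using g by blast
qed

lemma trivial_mod_scale:
  assumes "trivial_mod S w f"
  shows "trivial_mod S w (scale d f)"
proof -
  obtain n :: nat and c a s b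
    where f: "f = (\<Sum>i<n. scale (c i) (word (a i) * s i * word (b i)))"
      and terms: "\<forall>i<n. s i \<in> S \<and> a i @ lead_word (s i) @ b i < w"
    using assms unfolding trivial_mod_def by blast
  have "scale d f = (\<Sum>i<n. scale (d * c i) (word (a i) * s i * word (b i)))"
    by (simp add: f scale_conv_mult sum_distrib_left mult_single mult.assoc [symmetric])
  then show ?thesis
    unfolding trivial_mod_def using terms
    by (intro exI [of _ n] exI [of _ "\<lambda>i. d * c i"] exI [of _ a] exI [of _ s] exI [of _ b] conjI)
qed

text \<open>An equivalence relation between polynomials, so that a composition can be shown to be trivial by
  a chain of rewriting steps that joins its two parts.\<close>

definition cong_below ::
    "('x::linorder, 'k::field) ncpoly set \<Rightarrow> 'x list \<Rightarrow> ('x, 'k) ncpoly \<Rightarrow> ('x, 'k) ncpoly \<Rightarrow> bool"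
  where "cong_below S w f g \<longleftrightarrow> trivial_mod S w (f - g)"

lemma cong_below_sym: "cong_below S w f g \<Longrightarrow> cong_below S w g f"
  using trivial_mod_scale [of S w "f - g" "-1"]
  by (simp add: cong_below_def scale_uminus)

lemma cong_below_trans [trans]:
  "cong_below S w f g \<Longrightarrow> cong_below S w g h \<Longrightarrow> cong_below S w f h"
  using trivial_mod_add [of S w "f - g" "g - h"] by (simp add: cong_below_def)


section \<open>Quadratic binomial rewriting systems\<close>

text \<open>The rule that replaces the word \<open>u\<close> by \<open>c\<close> times the word \<open>v\<close>, as a polynomial.\<close>

definition rule_poly :: "'x list \<times> 'k \<times> 'x list \<Rightarrow> ('x, 'k::field) ncpoly"
  where "rule_poly = (\<lambda>(u, c, v). word u - scale c (word v))"

lemma lookup_rule_poly: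
  "Poly_Mapping.lookup (rule_poly (u, c, v)) t =
    (if t = u then 1 else 0) - (if t = v then c else 0)"
  using lookup_scale_word [of 1 u t]
  by (simp add: rule_poly_def lookup_minus lookup_scale_word)

lemma lead_word_rule_poly:
  assumes "v < u"
  shows "lead_word (rule_poly (u, c, v)) = u"
  unfolding lead_word_def
proof (rule Max_eqI)
  show "u \<in> Poly_Mapping.keys (rule_poly (u, c, v))"
    using assms by (auto simp: in_keys_iff lookup_rule_poly)
  show "t \<le> u" if "t \<in> Poly_Mapping.keys (rule_poly (u, c, v))" for t
    using that assms by (auto simp: in_keys_iff lookup_rule_poly split: if_splits)
qed simp

lemma monic_rule_poly:
  assumes "v < u"
  shows "monic (rule_poly (u, c, v))"
proof -
  have "Poly_Mapping.lookup (rule_poly (u, c, v)) u = 1"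
    using assms by (auto simp: lookup_rule_poly)
  moreover from this have "rule_poly (u, c, v) \<noteq> 0"
    by auto
  ultimately show ?thesis
    using assms by (simp add: monic_def lead_word_rule_poly)
qed

text \<open>Rewriting one factor of a word subtracts a multiple of a rule whose leading word in context
  is the word itself, so it does not leave the congruence class as long as that word is below
  the bound.\<close>

lemma cong_below_rewrite:
  assumes "(u, c, v) \<in> R" and "v < u" and "a @ u @ b < w"
  shows "cong_below (rule_poly ` R) w
    (scale d (word (a @ u @ b))) (scale (d * c) (word (a @ v @ b)))"
proof -
  have "word a * rule_poly (u, c, v) * word b =
      word (a @ u @ b) - scale c (word (a @ v @ b))"
    by (simp add: rule_poly_def algebra_simps word_mult word_mult_scale scale_mult_word)
  then have "scale d (word (a @ u @ b)) - scale (d * c) (word (a @ v @ b)) =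
      0 + scale d (word a * rule_poly (u, c, v) * word b)"
    by (simp add: scale_diff)
  then show ?thesis
    unfolding cong_below_def
    using trivial_mod_add_term [OF trivial_mod_zero, of "rule_poly (u, c, v)" "rule_poly ` R" a b w d]
      assms lead_word_rule_poly [OF assms(2)]
    by (metis imageI)
qed

text \<open>For left-hand sides of length two the only nontrivial overlaps are words \<open>[x, y, z]\<close> whose
  two two-letter factors are both left-hand sides; complete overlaps and inclusions make the two rules
  equal and their composition zero. Cancelling the word \<open>[x, y, z]\<close> itself leaves the difference of its
  two one-step rewritings.\<close>

lemma groebner_shirshov_basis_quadratic:
  fixes R :: "('x::linorder list \<times> 'k::field \<times> 'x list) set"
  assumes nonempty: "R \<noteq> {}"
    and quadratic: "\<And>u c v. (u, c, v) \<in> R \<Longrightarrow> length u = 2"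
    and decreasing: "\<And>u c v. (u, c, v) \<in> R \<Longrightarrow> v < u"
    and functional: "\<And>u c v c' v'. (u, c, v) \<in> R \<Longrightarrow> (u, c', v') \<in> R \<Longrightarrow> c = c' \<and> v = v'"
    and confluent: "\<And>x y z c v c' v'. ([x, y], c, v) \<in> R \<Longrightarrow> ([y, z], c', v') \<in> R \<Longrightarrow>
      cong_below (rule_poly ` R) [x, y, z] (scale c (word (v @ [z]))) (scale c' (word (x # v')))"
  shows "groebner_shirshov_basis (rule_poly ` R)"
proof -
  have "trivial_mod (rule_poly ` R) w h"
    if fg: "f \<in> rule_poly ` R" "g \<in> rule_poly ` R" and comp: "composition f g w h" for f g w h
  proof -
    obtain u c v where f: "f = rule_poly (u, c, v)" and uR: "(u, c, v) \<in> R"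
      using fg(1) by auto
    obtain u' c' v' where g: "g = rule_poly (u', c', v')" and uR': "(u', c', v') \<in> R"
      using fg(2) by auto
    have lead: "lead_word f = u" "lead_word g = u'"
      using f g lead_word_rule_poly decreasing uR uR' by blast+
    have len: "length u = 2" "length u' = 2"
      using quadratic uR uR' by blast+
    have same: "f = g" if "u = u'"
      using functional uR uR' that f g by blast
    from comp show ?thesis
    proof cases
      case (intersection a b)
      have w: "u @ a = b @ u'" and "length a < 2" and ab: "length a = length b"
        using intersection lead len by (auto dest: arg_cong [of _ _ length])
      show ?thesis
      proof (cases a)
        case Nil
        then have "b = []" "u = u'" using w ab by auto
        then show ?thesis
          using same Nil intersection word_mult [of "[]"]
          by (simp add: word_def trivial_mod_zero flip: zero_list_def)
      next
        case (Cons z a')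
        then have a: "a = [z]" using \<open>length a < 2\<close> by simp
        obtain x where b: "b = [x]" using ab a by (cases b) auto
        obtain y where u: "u = [x, y]" and u': "u' = [y, z]"
          using w len unfolding a b by (auto simp: numeral_2_eq_2 length_Suc_conv)
        have "f * word a - word b * g =
            scale c' (word (x # v')) - scale c (word (v @ [z]))"
          by (simp add: f g a b u u' rule_poly_def algebra_simps word_mult word_mult_scale
              scale_mult_word)
        moreover have "w = [x, y, z]"
          using intersection lead u a by simp
        ultimately show ?thesis
          using cong_below_sym [OF confluent] uR uR' intersection u u'
          by (simp add: cong_below_def)
      qed
    next
      case (inclusion a b)
      then have "u = a @ u' @ b" using lead by simp
      with len have "a = []" "b = []" "u = u'"
        by (auto dest: arg_cong [of _ _ length])
      then show ?thesis
        using same inclusion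
        by (simp add: word_def trivial_mod_zero flip: zero_list_def)
    qed
  qed
  moreover have "\<forall>f\<in>rule_poly ` R. monic f"
    using monic_rule_poly decreasing by fast
  ultimately show ?thesis
    using nonempty by (auto simp: groebner_shirshov_basis_def)
qed


section \<open>The rules of the algebra\<close>

text \<open>Moving \<open>x\<^sub>i\<close> to the right past \<open>y\<^sub>j\<close> swaps \<open>y\<^sub>1\<close> and \<open>y\<^sub>2\<close> and produces a scalar that depends
  on \<open>i\<close> only.\<close>

fun swap_gen :: "gen \<Rightarrow> gen"
  where "swap_gen Y1 = Y2" | "swap_gen Y2 = Y1" | "swap_gen z = z"

definition pass_coeff :: "'k::field \<Rightarrow> gen \<Rightarrow> 'k"
  where "pass_coeff \<alpha> x = (if x = X1 then 1 / \<alpha> else 1)"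

inductive_set rules :: "'k::field \<Rightarrow> 'k \<Rightarrow> (gen list \<times> 'k \<times> gen list) set"
  for q \<alpha> :: "'k::field"
  where
    xx: "([X2, X1], q, [X1, X2]) \<in> rules q \<alpha>"
  | yy: "([Y2, Y1], -1, [Y1, Y2]) \<in> rules q \<alpha>"
  | xy: "x \<in> {X1, X2} \<Longrightarrow> y \<in> {Y1, Y2} \<Longrightarrow>
      ([x, y], pass_coeff \<alpha> x, [swap_gen y, x]) \<in> rules q \<alpha>"

lemma rules_eq:
  "rules q \<alpha> = {([X2, X1], q, [X1, X2]), ([Y2, Y1], -1, [Y1, Y2]),
    ([X1, Y2], 1 / \<alpha>, [Y1, X1]), ([X2, Y2], 1, [Y1, X2]),
    ([X1, Y1], 1 / \<alpha>, [Y2, X1]), ([X2, Y1], 1, [Y2, X2])}"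
    (is "_ = ?R")
proof
  show "rules q \<alpha> \<subseteq> ?R"
  proof (rule subsetI, unfold split_paired_all)
    show "(u, c, v) \<in> ?R" if "(u, c, v) \<in> rules q \<alpha>" for u c v
      using that by cases (auto simp: pass_coeff_def)
  qed
  show "?R \<subseteq> rules q \<alpha>"
    using rules.xx [of q \<alpha>] rules.yy [of q \<alpha>]
      rules.xy [of X1 Y1 \<alpha> q] rules.xy [of X1 Y2 \<alpha> q]
      rules.xy [of X2 Y1 \<alpha> q] rules.xy [of X2 Y2 \<alpha> q]
    by (simp add: pass_coeff_def)
qed

lemma GS_set_eq: "GS_set q \<alpha> = rule_poly ` rules q \<alpha>"
  by (simp add: rules_eq GS_set_def rule_poly_def word_mult scale_uminus)

lemma rules_decreasing: "(u, c, v) \<in> rules q \<alpha> \<Longrightarrow> v < u"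
  by (auto simp: rules_eq Cons_less_Cons less_gen_def)

lemma cong_below_rules:
  assumes "(u, c, v) \<in> rules q \<alpha>" and "a @ u @ b < w"
  shows "cong_below (GS_set q \<alpha>) w
    (scale d (word (a @ u @ b))) (scale (d * c) (word (a @ v @ b)))"
  unfolding GS_set_eq
  by (rule cong_below_rewrite [OF assms(1) rules_decreasing [OF assms(1)] assms(2)])

text \<open>Moving \<open>y\<close> to the left past \<open>x\<^sub>1\<close> and \<open>x\<^sub>2\<close>, in whichever order they stand, gives the same total
  coefficient and restores \<open>y\<close>, so it commutes with exchanging \<open>x\<^sub>2\<close> and \<open>x\<^sub>1\<close>.\<close>

lemma overlap_xxy:
  assumes "y \<in> {Y1, Y2}"
  shows "cong_below (GS_set q \<alpha>) [X2, X1, y]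
    (scale q (word [X1, X2, y])) (scale (pass_coeff \<alpha> X1) (word [X2, swap_gen y, X1]))"
proof -
  let ?w = "[X2, X1, y]" and ?S = "GS_set q \<alpha>" and ?p = "pass_coeff \<alpha>"
  have y': "swap_gen y \<in> {Y1, Y2}" "swap_gen (swap_gen y) = y"
    using assms by auto
  have "cong_below ?S ?w (scale q (word [X1, X2, y])) (scale (q * ?p X2) (word [X1, swap_gen y, X2]))"
    using cong_below_rules [OF rules.xy [of X2 y], of "[X1]" "[]" ?w q \<alpha> q] assms
    by (auto simp: Cons_less_Cons less_gen_def)
  also have "cong_below ?S ?w \<dots> (scale (q * ?p X2 * ?p X1) (word [y, X1, X2]))"
    using cong_below_rules [OF rules.xy [of X1 "swap_gen y"], of "[]" "[X2]" ?w q \<alpha> "q * ?p X2"] y'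
    by (auto simp: Cons_less_Cons less_gen_def)
  also have "\<dots> = scale (?p X1 * ?p X2 * q) (word [y, X1, X2])"
    by (simp add: mult_ac)
  also have "cong_below ?S ?w \<dots> (scale (?p X1 * ?p X2) (word [y, X2, X1]))"
    using cong_below_sym [OF cong_below_rules [OF rules.xx,
        of "[y]" "[]" ?w q \<alpha> "?p X1 * ?p X2"]] assms
    by (auto simp: Cons_less_Cons less_gen_def)
  also have "cong_below ?S ?w \<dots> (scale (?p X1) (word [X2, swap_gen y, X1]))"
    using cong_below_sym [OF cong_below_rules [OF rules.xy [of X2 "swap_gen y"], of "[]" "[X1]" ?w q \<alpha> "?p X1"]] y'
    by (auto simp: Cons_less_Cons less_gen_def)
  finally show ?thesis .
qed

text \<open>The relation \<open>y\<^sub>2 y\<^sub>1 = - y\<^sub>1 y\<^sub>2\<close> is invariant under the swap of \<open>y\<^sub>1\<close> and \<open>y\<^sub>2\<close>,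
  and \<open>x\<close> passes both products with the same coefficient.\<close>

lemma overlap_xyy:
  assumes "x \<in> {X1, X2}"
  shows "cong_below (GS_set q \<alpha>) [x, Y2, Y1]
    (scale (pass_coeff \<alpha> x) (word [Y1, x, Y1])) (scale (-1) (word [x, Y1, Y2]))"
proof -
  let ?w = "[x, Y2, Y1]" and ?S = "GS_set q \<alpha>" and ?p = "pass_coeff \<alpha> x"
  have "cong_below ?S ?w (scale (-1) (word [x, Y1, Y2])) (scale (- ?p) (word [Y2, x, Y2]))"
    using cong_below_rules [OF rules.xy [of x Y1], of "[]" "[Y2]" ?w q \<alpha> "-1"] assms
    by (auto simp: Cons_less_Cons less_gen_def)
  also have "cong_below ?S ?w \<dots> (scale (- ?p * ?p) (word [Y2, Y1, x]))"
    using cong_below_rules [OF rules.xy [of x Y2], of "[Y2]" "[]" ?w q \<alpha> "- ?p"] assms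
    by (auto simp: Cons_less_Cons less_gen_def)
  also have "cong_below ?S ?w \<dots> (scale (?p * ?p) (word [Y1, Y2, x]))"
    using cong_below_rules [OF rules.yy, of "[]" "[x]" ?w q \<alpha> "- ?p * ?p"] assms
    by (auto simp: Cons_less_Cons less_gen_def)
  also have "cong_below ?S ?w \<dots> (scale ?p (word [Y1, x, Y1]))"
    using cong_below_sym [OF cong_below_rules [OF rules.xy [of x Y1], of "[Y1]" "[]" ?w q \<alpha> "?p"]] assms
    by (auto simp: Cons_less_Cons less_gen_def)
  finally show ?thesis by (rule cong_below_sym)
qed

lemma groebner_shirshov_basis_GS_set: "groebner_shirshov_basis (GS_set q \<alpha>)"
  unfolding GS_set_eq
proof (rule groebner_shirshov_basis_quadratic)
  show "rules q \<alpha> \<noteq> {}"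
    by (auto simp: rules_eq)
  show "length u = 2" if "(u, c, v) \<in> rules q \<alpha>" for u c v
    using that by (auto simp: rules_eq)
  show "v < u" if "(u, c, v) \<in> rules q \<alpha>" for u c v
    using that by (rule rules_decreasing)
  show "c = c' \<and> v = v'" if "(u, c, v) \<in> rules q \<alpha>" "(u, c', v') \<in> rules q \<alpha>" for u c v c' v'
    using that by (auto simp: rules_eq)
  show "cong_below (rule_poly ` rules q \<alpha>) [x, y, z]
      (scale c (word (v @ [z]))) (scale c' (word (x # v')))"
    if "([x, y], c, v) \<in> rules q \<alpha>" "([y, z], c', v') \<in> rules q \<alpha>" for x y z c v c' v'
  proof -
    \<comment> \<open>An \<open>x\<close> may be followed by a \<open>y\<close> on a left-hand side, but not conversely; and no letter
      can be both the smaller and the larger of an \<open>xx\<close> or \<open>yy\<close> pair.\<close>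
    have "x = X2 \<and> y = X1 \<and> z \<in> {Y1, Y2} \<and> c = q \<and> v = [X1, X2] \<and>
          c' = pass_coeff \<alpha> X1 \<and> v' = [swap_gen z, X1] \<or>
        x \<in> {X1, X2} \<and> y = Y2 \<and> z = Y1 \<and> c = pass_coeff \<alpha> x \<and> v = [Y1, x] \<and>
          c' = -1 \<and> v' = [Y1, Y2]"
      using that by (auto elim!: rules.cases)
    then show ?thesis
      using overlap_xxy [of z q \<alpha>] overlap_xyy [of x q \<alpha>] by (auto simp flip: GS_set_eq)
  qed
qed


section \<open>Ideals of the free algebra\<close>

lemma ring_free_alg: "ring free_alg"
proof (rule ringI)
  show "abelian_group free_alg"
    by (rule abelian_groupI) (auto simp: free_alg_def algebra_simps intro: exI [of _ "- _"])
  show "monoid free_alg"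
    by (rule monoidI) (auto simp: free_alg_def mult.assoc)
qed (auto simp: free_alg_def algebra_simps)

lemma ideal_gen_ideal: "ideal (gen_ideal S) free_alg"
  unfolding gen_ideal_def
  by (rule ring.genideal_ideal [OF ring_free_alg]) (simp add: free_alg_def)

text \<open>Scaling is multiplication by a constant polynomial, so ideals absorb it.\<close>

lemma scale_in_gen_ideal:
  assumes "f \<in> S"
  shows "scale c f \<in> gen_ideal S"
proof -
  have "S \<subseteq> gen_ideal S"
    unfolding gen_ideal_def
    by (rule ring.genideal_self [OF ring_free_alg]) (simp add: free_alg_def)
  then show ?thesis
    using ideal.I_l_closed [OF ideal_gen_ideal, of f S "Poly_Mapping.single 0 c"] assms
    by (auto simp: free_alg_def scale_conv_mult)
qed

lemma gen_ideal_subset_of_multiples: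
  assumes "\<And>f. f \<in> S \<Longrightarrow> \<exists>c. \<exists>g\<in>T. f = scale c g"
  shows "gen_ideal S \<subseteq> gen_ideal T"
  unfolding gen_ideal_def [of S]
  by (rule ring.genideal_minimal [OF ring_free_alg ideal_gen_ideal])
    (use assms scale_in_gen_ideal in blast)

lemma gen_ideal_relations:
  assumes "\<alpha> \<noteq> 0"
  shows "gen_ideal {l - r | l r. (l, r) \<in> L_rels q \<alpha>} = gen_ideal (GS_set q \<alpha>)"
    (is "gen_ideal ?D = _")
proof
  have D: "?D = {x2 * x1 - scale q (x1 * x2), y2 * y1 + y1 * y2,
      scale (- \<alpha>) (x1 * y2 - scale (1 / \<alpha>) (y1 * x1)), scale (-1) (x2 * y2 - y1 * x2),
      scale (- \<alpha>) (x1 * y1 - scale (1 / \<alpha>) (y2 * x1)), scale (-1) (x2 * y1 - y2 * x2)}"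
  proof -
    have "?D = (\<lambda>(l, r). l - r) ` L_rels q \<alpha>"
      by force
    then show ?thesis
      using assms by (simp add: L_rels_def scale_diff scale_uminus)
  qed
  show "gen_ideal ?D \<subseteq> gen_ideal (GS_set q \<alpha>)"
  proof (rule gen_ideal_subset_of_multiples)
    show "\<exists>c. \<exists>g\<in>GS_set q \<alpha>. f = scale c g" if "f \<in> ?D" for f
      using that scale_one [of f] unfolding D GS_set_def
      by (elim insertE emptyE) (metis insertI1 insertI2)+
  qed
  show "gen_ideal (GS_set q \<alpha>) \<subseteq> gen_ideal ?D"
  proof (rule gen_ideal_subset_of_multiples)
    fix f
    assume "f \<in> GS_set q \<alpha>"
    then consider "f \<in> ?D" | "scale (- \<alpha>) f \<in> ?D" | "scale (-1) f \<in> ?D"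
      unfolding D GS_set_def by blast
    moreover have "f = scale 1 f" "f = scale (- 1 / \<alpha>) (scale (- \<alpha>) f)" "f = scale (-1) (scale (-1) f)"
      using assms by simp_all
    ultimately show "\<exists>c. \<exists>g\<in>?D. f = scale c g"
      by cases blast+
  qed
qed

text \<open>The zero of the quotient is the ideal itself, as the coset of \<open>0\<close>.\<close>

lemma defining_relations_ideal_eq:
  "defining_relations_ideal Rel = gen_ideal {l - r | l r. (l, r) \<in> Rel}"
    (is "_ = ?I")
proof -
  interpret ideal ?I free_alg by (rule ideal_gen_ideal)
  have "?I +>\<^bsub>free_alg\<^esub> f = ?I \<longleftrightarrow> f \<in> ?I" for f
    using a_coset_join1 a_coset_join2 a_subgroup by (auto simp: free_alg_def)
  moreover have "\<zero>\<^bsub>presented_alg Rel\<^esub> = ?I"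
    by (simp add: presented_alg_def quot_alg_def ring.defs module.defs FactRing_def)
  ultimately show ?thesis
    unfolding defining_relations_ideal_def a_kernel_def'
    by (simp add: free_alg_def)
qed

theorem mainTheorem7:
  fixes q \<alpha> :: "'k::field"
  assumes "q \<in> {-1, 1}" and "\<alpha> \<noteq> 0"
  shows "groebner_shirshov_basis (GS_set q \<alpha>) \<and>
    gen_ideal (GS_set q \<alpha>) = defining_relations_ideal (L_rels q \<alpha>) \<and>
    L_alg q \<alpha> = quot_alg free_alg (gen_ideal (GS_set q \<alpha>))"
  using groebner_shirshov_basis_GS_set gen_ideal_relations [OF assms(2)]
  by (simp add: defining_relations_ideal_eq L_alg_def presented_alg_def)

end
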